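(* Let $n\ge 2$ and let $f(t)$, $t<0$, be a real $C^\infty$-function satisfying the inequalities $$f'(t)>0,\qquad f'(t)+t f''(t)<0 .$$ Then $$g_{\alpha\bar\beta}=\partial_\alpha\partial_{\bar\beta}\, f(-r^2)$$ are the local components of a (positive definite) Kähler metric $g$ on the time-like domain $\mathbb T^{n-1}_1\subset\mathbb C^n$.
   Context: On $\mathbb C^n=\{\mathbf Z=(z^1,\dots,z^n)\}$ with its standard complex structure, $h'$ is the flat Kähler-Lorentz metric of signature $(2(n-1),2)$ with $h'(\mathbf Z,\mathbf Z)=|z^1|^2+\dots+|z^{n-1}|^2-|z^n|^2$. The time-like domain is $\mathbb T^{n-1}_1=\{\mathbf Z\in\mathbb C^n : h'(\mathbf Z,\mathbf Z)<0\}$. On it the function $r>0$ is defined by $-r^2=h'(\mathbf Z,\mathbf Z)$. $\partial_\alpha=\partial/\partial z^\alpha$, $\partial_{\bar\beta}=\partial/\partial \bar z^{\beta}$, $\alpha,\beta=1,\dots,n$; $g_{\alpha\bar\beta}=g(\partial_\alpha,\partial_{\bar\beta})$ are the components of the complex-bilinear extension of the Hermitian (i.e. $J$-invariant) metric $g$, with $g_{\alpha\beta}=g_{\bar\alpha\bar\beta}=0$. *)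

theory Defs
  imports "HOL-Analysis.Analysis"
begin

primrec times_differentiable_on ::
    "nat \<Rightarrow> ('a::real_normed_vector \<Rightarrow> 'b::real_normed_vector) \<Rightarrow> 'a set \<Rightarrow> bool" where
  "times_differentiable_on 0 F S \<longleftrightarrow> continuous_on S F"
| "times_differentiable_on (Suc m) F S \<longleftrightarrow>
     (\<forall>x\<in>S. F differentiable (at x)) \<and>
     (\<forall>v. times_differentiable_on m (\<lambda>x. frechet_derivative F (at x) v) S)"

text \<open>Real \<open>C\<^sup>\<infinity>\<close>-smoothness; meant for open \<open>S\<close>. Complex spaces are treated as real
  normed spaces here, so this is not holomorphy.\<close>

definition smooth_on ::
    "'a::real_normed_vector set \<Rightarrow> ('a \<Rightarrow> 'b::real_normed_vector) \<Rightarrow> bool" where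
  "smooth_on S F \<longleftrightarrow> (\<forall>m. times_differentiable_on m F S)"

text \<open>The standard complex structure, all real tangent spaces of \<open>\<complex>\<^sup>n\<close> being identified
  with \<open>\<complex>\<^sup>n\<close>.\<close>

definition J :: "complex ^ 'n \<Rightarrow> complex ^ 'n" where
  "J X = \<i> *s X"

text \<open>The flat Kaehler-Lorentz metric. The parameter \<open>k\<close> is the index of the single
  coordinate that enters with the negative sign. On \<^typ>\<open>complex\<close> the inner product
  \<open>a \<bullet> b\<close> is the real part of \<open>a * cnj b\<close>.\<close>

definition lorentz :: "'n::finite \<Rightarrow> complex ^ 'n \<Rightarrow> complex ^ 'n \<Rightarrow> real" where
  "lorentz k X Y = (\<Sum>\<alpha>\<in>UNIV - {k}. X $ \<alpha> \<bullet> Y $ \<alpha>) - X $ k \<bullet> Y $ k"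

definition timelike_domain :: "'n::finite \<Rightarrow> (complex ^ 'n) set" where
  "timelike_domain k = {Z. lorentz k Z Z < 0}"

definition timelike_radius :: "'n::finite \<Rightarrow> complex ^ 'n \<Rightarrow> real" where
  "timelike_radius k Z = sqrt (- lorentz k Z Z)"

definition partial_along ::
    "complex ^ 'n::finite \<Rightarrow> (complex ^ 'n \<Rightarrow> complex) \<Rightarrow> complex ^ 'n \<Rightarrow> complex" where
  "partial_along v F Z = vector_derivative (\<lambda>s::real. F (Z + s *\<^sub>R v)) (at 0)"

text \<open>With \<open>z\<^sup>\<alpha> = x\<^sup>\<alpha> + \<i> y\<^sup>\<alpha>\<close>, the coordinate fields of \<open>x\<^sup>\<alpha>\<close> and \<open>y\<^sup>\<alpha>\<close> are the constants
  \<open>axis \<alpha> 1\<close> and \<open>axis \<alpha> \<i>\<close>.\<close>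

definition d_z :: "'n::finite \<Rightarrow> (complex ^ 'n \<Rightarrow> complex) \<Rightarrow> complex ^ 'n \<Rightarrow> complex" where
  "d_z \<alpha> F Z = (partial_along (axis \<alpha> 1) F Z - \<i> * partial_along (axis \<alpha> \<i>) F Z) / 2"

definition d_zbar :: "'n::finite \<Rightarrow> (complex ^ 'n \<Rightarrow> complex) \<Rightarrow> complex ^ 'n \<Rightarrow> complex" where
  "d_zbar \<alpha> F Z = (partial_along (axis \<alpha> 1) F Z + \<i> * partial_along (axis \<alpha> \<i>) F Z) / 2"

type_synonym 'n tensor2 = "complex ^ 'n \<Rightarrow> complex ^ 'n \<Rightarrow> complex ^ 'n \<Rightarrow> real"

text \<open>For a covariant 2-tensor field \<open>g\<close>, \<open>g Z X Y\<close> is its value at the point \<open>Z\<close> on the real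
  tangent vectors \<open>X\<close> and \<open>Y\<close>.\<close>

definition riemannian_metric_on :: "(complex ^ 'n::finite) set \<Rightarrow> 'n tensor2 \<Rightarrow> bool" where
  "riemannian_metric_on U g \<longleftrightarrow>
     (\<forall>Z\<in>U. bilinear (g Z)) \<and>
     (\<forall>Z\<in>U. \<forall>X Y. g Z X Y = g Z Y X) \<and>
     (\<forall>Z\<in>U. \<forall>X. X \<noteq> 0 \<longrightarrow> g Z X X > 0) \<and>
     (\<forall>X Y. smooth_on U (\<lambda>Z. g Z X Y))"

definition hermitian_metric_on :: "(complex ^ 'n::finite) set \<Rightarrow> 'n tensor2 \<Rightarrow> bool" where
  "hermitian_metric_on U g \<longleftrightarrow>
     riemannian_metric_on U g \<and> (\<forall>Z\<in>U. \<forall>X Y. g Z (J X) (J Y) = g Z X Y)"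

definition fundamental_form :: "'n tensor2 \<Rightarrow> 'n::finite tensor2" where
  "fundamental_form g Z X Y = g Z (J X) Y"

text \<open>\<open>d\<omega> = 0\<close>, evaluated on constant vector fields; these commute, so the bracket terms in
  the invariant formula for \<open>d\<omega>\<close> vanish.\<close>

definition closed_form_on :: "(complex ^ 'n::finite) set \<Rightarrow> 'n tensor2 \<Rightarrow> bool" where
  "closed_form_on U \<omega> \<longleftrightarrow>
     (\<forall>Z\<in>U. \<forall>V X Y.
        frechet_derivative (\<lambda>P. \<omega> P X Y) (at Z) V
      + frechet_derivative (\<lambda>P. \<omega> P Y V) (at Z) X
      + frechet_derivative (\<lambda>P. \<omega> P V X) (at Z) Y = 0)"

definition kaehler_metric_on :: "(complex ^ 'n::finite) set \<Rightarrow> 'n tensor2 \<Rightarrow> bool" where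
  "kaehler_metric_on U g \<longleftrightarrow>
     open U \<and> hermitian_metric_on U g \<and> closed_form_on U (fundamental_form g)"

text \<open>A complexified tangent vector \<open>V + \<i> W\<close>, with \<open>V\<close> and \<open>W\<close> real tangent vectors and \<open>\<i>\<close>
  the scalar of the complexification (not \<^const>\<open>J\<close>), is the pair \<open>(V, W)\<close>.\<close>

type_synonym 'n ctangent = "(complex ^ 'n) \<times> (complex ^ 'n)"

definition del :: "'n::finite \<Rightarrow> 'n ctangent" where
  "del \<alpha> = ((1/2) *\<^sub>R axis \<alpha> 1, - ((1/2) *\<^sub>R axis \<alpha> \<i>))"

definition delbar :: "'n::finite \<Rightarrow> 'n ctangent" where
  "delbar \<alpha> = ((1/2) *\<^sub>R axis \<alpha> 1, (1/2) *\<^sub>R axis \<alpha> \<i>)"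

definition complex_ext ::
    "'n::finite tensor2 \<Rightarrow> complex ^ 'n \<Rightarrow> 'n ctangent \<Rightarrow> 'n ctangent \<Rightarrow> complex" where
  "complex_ext g Z A B =
     Complex (g Z (fst A) (fst B) - g Z (snd A) (snd B))
             (g Z (fst A) (snd B) + g Z (snd A) (fst B))"

definition has_local_components ::
    "(complex ^ 'n::finite) set \<Rightarrow> 'n tensor2 \<Rightarrow> ('n \<Rightarrow> 'n \<Rightarrow> complex ^ 'n \<Rightarrow> complex) \<Rightarrow> bool" where
  "has_local_components U g G \<longleftrightarrow>
     (\<forall>Z\<in>U. \<forall>\<alpha> \<beta>.
        complex_ext g Z (del \<alpha>) (delbar \<beta>) = G \<alpha> \<beta> Z \<and>
        complex_ext g Z (del \<alpha>) (del \<beta>) = 0 \<and>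
        complex_ext g Z (delbar \<alpha>) (delbar \<beta>) = 0)"

end

theory Submission
  imports Defs
begin

text \<open>Write \<open>q = h'(Z, Z) = -r\<^sup>2\<close> and let \<open>A\<close> be the Hermitian product of \<open>X\<close> and \<open>Z\<close>. Then
  \<open>g(X, X) = 2 (f'(q) h'(X, X) + f''(q) |A|\<^sup>2)\<close>, and the hypotheses give \<open>f''(q) > 0\<close>. If
  \<open>h'(X, X) > 0\<close>, both terms are nonnegative and the first is positive. Otherwise the reversed
  Cauchy--Schwarz inequality \<open>|A|\<^sup>2 \<ge> h'(X, X) q\<close> bounds \<open>g(X, X)\<close> from below by
  \<open>2 h'(X, X) (f'(q) + q f''(q))\<close>, with \<open>A \<noteq> 0\<close> settling the null case. The fundamental form is
  closed because its derivative, summed cyclically, cancels.\<close>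

section \<open>Closure properties of \<open>C\<^sup>m\<close> functions\<close>

text \<open>Differentiability gives continuity at the bottom; above it the induction descends to the
  directional derivatives, so \<open>F\<close> must stay arbitrary.\<close>

lemma times_differentiable_on_Suc_imp:
  "times_differentiable_on (Suc m) F S \<Longrightarrow> times_differentiable_on m F S"
proof (induction m arbitrary: F)
  case 0
  then show ?case
    by (auto intro!: continuous_at_imp_continuous_on differentiable_imp_continuous_within)
next
  case (Suc m)
  show ?case
    unfolding times_differentiable_on.simps(2)[of m]
    using Suc.prems Suc.IH times_differentiable_on.simps(2)[of "Suc m"] by blast
qed

text \<open>Since \<open>S\<close> is open, the derivative at a point of \<open>S\<close> depends
  only on values inside \<open>S\<close>. This allows closed formulas valid only on \<open>S\<close>
  to replace the original functions.\<close>

lemma times_differentiable_on_cong: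
  assumes "open S" "\<And>x. x \<in> S \<Longrightarrow> F x = G x" "times_differentiable_on m F S"
  shows "times_differentiable_on m G S"
  using assms(2,3)
proof (induction m arbitrary: F G)
  case 0
  then show ?case using continuous_on_cong[of S S F G] by simp
next
  case (Suc m)
  have D: "(G has_derivative frechet_derivative F (at x)) (at x)" if "x \<in> S" for x
  proof (rule has_derivative_transform_within_open[OF _ assms(1) that])
    show "(F has_derivative frechet_derivative F (at x)) (at x)"
      using Suc.prems(2) that frechet_derivative_works by auto
  qed (rule Suc.prems(1))
  then have "frechet_derivative F (at x) = frechet_derivative G (at x)" if "x \<in> S" for x
    using that frechet_derivative_at by blast
  moreover have "times_differentiable_on m (\<lambda>x. frechet_derivative F (at x) v) S" for v
    using Suc.prems by simp
  ultimately have "times_differentiable_on m (\<lambda>x. frechet_derivative G (at x) v) S" for v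
    using Suc.IH[of "\<lambda>x. frechet_derivative F (at x) v" "\<lambda>x. frechet_derivative G (at x) v"] by simp
  moreover have "\<forall>x\<in>S. G differentiable at x"
    using D unfolding differentiable_def by blast
  ultimately show ?case by simp
qed

text \<open>Trades \<open>frechet_derivative\<close> for an explicit derivative \<open>D\<close>,
  which the closure proofs read off from the usual differentiation rules.\<close>

lemma times_differentiable_on_SucI:
  assumes "open S" "\<And>x. x \<in> S \<Longrightarrow> (F has_derivative D x) (at x)"
    "\<And>v. times_differentiable_on m (\<lambda>x. D x v) S"
  shows "times_differentiable_on (Suc m) F S"
proof -
  have "times_differentiable_on m (\<lambda>x. frechet_derivative F (at x) v) S" for v
    by (rule times_differentiable_on_cong[OF assms(1) _ assms(3)[of v]])
      (simp add: frechet_derivative_at[OF assms(2)])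
  then show ?thesis using assms(2) by (auto simp: differentiable_def)
qed

lemma times_differentiable_on_SucD:
  assumes "times_differentiable_on (Suc m) F S"
  shows "x \<in> S \<Longrightarrow> (F has_derivative frechet_derivative F (at x)) (at x)"
    and "times_differentiable_on m (\<lambda>x. frechet_derivative F (at x) v) S"
proof -
  show "x \<in> S \<Longrightarrow> (F has_derivative frechet_derivative F (at x)) (at x)"
    using assms frechet_derivative_works[of F "at x"] by (meson times_differentiable_on.simps(2))
  show "times_differentiable_on m (\<lambda>x. frechet_derivative F (at x) v) S"
    using assms unfolding times_differentiable_on.simps(2) by blast
qed

lemma times_differentiable_on_const:
  "open S \<Longrightarrow> times_differentiable_on m (\<lambda>_. c) S"
proof (induction m arbitrary: c)
  case (Suc m)
  then show ?case by (intro times_differentiable_on_SucI[where D = "\<lambda>_ _. 0"]) auto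
qed simp

lemma times_differentiable_on_bounded_linear:
  assumes "open S" "bounded_linear F"
  shows "times_differentiable_on m F S"
proof (cases m)
  case 0
  then show ?thesis using assms by (simp add: linear_continuous_on)
next
  case (Suc m')
  then show ?thesis
    using assms
    by (auto intro!: times_differentiable_on_SucI[where D = "\<lambda>_. F"]
        times_differentiable_on_const bounded_linear_imp_has_derivative simp del: times_differentiable_on.simps)
qed

lemma times_differentiable_on_add:
  assumes "open S" "times_differentiable_on m F S" "times_differentiable_on m G S"
  shows "times_differentiable_on m (\<lambda>x. F x + G x) S"
  using assms(2,3)
proof (induction m arbitrary: F G)
  case 0
  then show ?case by (simp add: continuous_on_add)
next
  case (Suc m)
  note F = times_differentiable_on_SucD[OF Suc.prems(1)]
    and G = times_differentiable_on_SucD[OF Suc.prems(2)]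
  show ?case
    by (rule times_differentiable_on_SucI[OF assms(1) has_derivative_add])
      (use F G in \<open>auto intro!: Suc.IH\<close>)
qed

lemma times_differentiable_on_mult:
  fixes F G :: "'a::real_normed_vector \<Rightarrow> 'b::real_normed_algebra"
  assumes "open S" "times_differentiable_on m F S" "times_differentiable_on m G S"
  shows "times_differentiable_on m (\<lambda>x. F x * G x) S"
  using assms(2,3)
proof (induction m arbitrary: F G)
  case 0
  then show ?case by (simp add: continuous_on_mult)
next
  case (Suc m)
  note F = times_differentiable_on_SucD[OF Suc.prems(1)]
    and G = times_differentiable_on_SucD[OF Suc.prems(2)]
  show ?case
    by (rule times_differentiable_on_SucI[OF assms(1) has_derivative_mult])
      \<comment> \<open>The product rule also leaves \<open>F\<close> and \<open>G\<close>
        themselves as factors, needed only to order \<open>m\<close>.\<close>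
      (use F G Suc.prems[THEN times_differentiable_on_Suc_imp] in
        \<open>auto intro!: Suc.IH times_differentiable_on_add[OF assms(1)]\<close>)
qed

text \<open>The chain rule replaces \<open>f\<close> by its derivative and keeps the inner
  \<open>q\<close>, so the induction generalizes over \<open>f\<close> alone.\<close>

lemma times_differentiable_on_compose:
  fixes f :: "real \<Rightarrow> real"
  assumes "open S" "open T" "q ` S \<subseteq> T"
    "times_differentiable_on m f T" "times_differentiable_on m q S"
  shows "times_differentiable_on m (\<lambda>x. f (q x)) S"
  using assms(4,5)
proof (induction m arbitrary: f)
  case 0
  then show ?case
    using continuous_on_compose2[of T f S q] assms(3) by simp
next
  case (Suc m)
  note f = times_differentiable_on_SucD[OF Suc.prems(1)]
    and q = times_differentiable_on_SucD[OF Suc.prems(2)]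
  have D: "((\<lambda>x. f (q x)) has_derivative
      (\<lambda>v. frechet_derivative q (at x) v * frechet_derivative f (at (q x)) 1)) (at x)"
    if "x \<in> S" for x
  proof -
    have fq: "(f has_derivative frechet_derivative f (at (q x))) (at (q x))"
      using f(1) that assms(3) by blast
    \<comment> \<open>In one real dimension a linear map is determined by its value at 1, so the
      chain rule becomes a product of real functions.\<close>
    have "frechet_derivative f (at (q x)) t = t * frechet_derivative f (at (q x)) 1" for t
      using linear_cmul[OF has_derivative_linear[OF fq], of t 1] by simp
    then have "(f has_derivative (\<lambda>t. t * frechet_derivative f (at (q x)) 1)) (at (q x))"
      by (intro has_derivative_eq_rhs[OF fq] ext)
    from has_derivative_compose[OF q(1)[OF that] this] show ?thesis .
  qed
  show ?case
    by (rule times_differentiable_on_SucI[where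
          D = "\<lambda>x v. frechet_derivative q (at x) v * frechet_derivative f (at (q x)) 1"])
      (intro assms(1) D times_differentiable_on_mult[OF assms(1) q(2)]
        Suc.IH[OF f(2) times_differentiable_on_Suc_imp[OF Suc.prems(2)]]; assumption)+
qed

lemma smooth_on_DERIV:
  fixes f :: "real \<Rightarrow> real"
  assumes "smooth_on T f" "t \<in> T"
  shows "(f has_field_derivative deriv f t) (at t)"
proof -
  have "f differentiable at t"
    using assms unfolding smooth_on_def by (meson times_differentiable_on.simps(2))
  then show ?thesis
    by (simp add: DERIV_deriv_iff_real_differentiable)
qed

lemma smooth_on_deriv:
  fixes f :: "real \<Rightarrow> real"
  assumes "open T" "smooth_on T f"
  shows "smooth_on T (deriv f)"
  unfolding smooth_on_def
proof
  fix m
  have "times_differentiable_on m (\<lambda>x. frechet_derivative f (at x) 1) T"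
    using assms(2) times_differentiable_on_SucD(2) unfolding smooth_on_def by blast
  moreover have "frechet_derivative f (at x) 1 = deriv f x" if "x \<in> T" for x
  proof -
    have "(f has_derivative (*) (deriv f x)) (at x)"
      using smooth_on_DERIV[OF assms(2) that] by (simp add: has_field_derivative_def)
    then show ?thesis
      using frechet_derivative_at by (metis mult.right_neutral)
  qed
  ultimately show "times_differentiable_on m (deriv f) T"
    using times_differentiable_on_cong[OF assms(1), of "\<lambda>x. frechet_derivative f (at x) 1"] by simp
qed

section \<open>The flat Lorentz form\<close>

abbreviation eps :: "'n \<Rightarrow> 'n \<Rightarrow> real" where
  "eps k \<alpha> \<equiv> (if \<alpha> = k then -1 else 1)"

text \<open>Moving the sign into \<open>eps\<close> gives one sum over all indices, so that the
  index \<open>k\<close> needs no separate treatment.\<close>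

lemma lorentz_eq_sum: "lorentz k X Y = (\<Sum>\<alpha>\<in>UNIV. eps k \<alpha> * (X $ \<alpha> \<bullet> Y $ \<alpha>))"
  unfolding lorentz_def
  using sum.remove[of UNIV k "\<lambda>\<alpha>. eps k \<alpha> * (X $ \<alpha> \<bullet> Y $ \<alpha>)"] by simp

lemma bounded_bilinear_lorentz: "bounded_bilinear (lorentz k)"
  unfolding bilinear_conv_bounded_bilinear[symmetric] bilinear_def lorentz_eq_sum
  by (auto intro!: linearI simp: inner_add_left inner_add_right sum.distrib algebra_simps sum_distrib_left)

interpretation lorentz: bounded_bilinear "lorentz k" for k
  by (rule bounded_bilinear_lorentz)

lemma lorentz_commute: "lorentz k X Y = lorentz k Y X"
  by (simp add: lorentz_def inner_commute)

lemma lorentz_J: "lorentz k (J X) (J Y) = lorentz k X Y"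
  by (simp add: lorentz_def J_def inner_complex_def algebra_simps)

lemma J_J: "J (J X) = - X"
  by (simp add: J_def vec_eq_iff)

text \<open>An isometry with square -1 is skew-adjoint.\<close>

lemma lorentz_J_left: "lorentz k (J X) Y = - lorentz k X (J Y)"
  using lorentz_J[of k X "J Y"] by (simp add: J_J lorentz.minus_right)

lemma lorentz_J_anticommute: "lorentz k (J X) Y = - lorentz k (J Y) X"
  by (simp only: lorentz_J_left[of k X Y] lorentz_commute[of k X "J Y"])

lemma linear_J: "linear J"
  by (auto intro!: linearI simp: J_def vec_eq_iff algebra_simps)

lemma axis_component: "axis \<alpha> c $ \<beta> = (if \<alpha> = \<beta> then c else 0)"
  by (auto simp: axis_def)

lemma lorentz_axis: "lorentz k Z (axis \<alpha> c) = eps k \<alpha> * (Z $ \<alpha> \<bullet> c)"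
proof -
  have "lorentz k Z (axis \<alpha> c) = (\<Sum>\<beta>\<in>UNIV. if \<beta> = \<alpha> then eps k \<alpha> * (Z $ \<alpha> \<bullet> c) else 0)"
    unfolding lorentz_eq_sum by (rule sum.cong) (auto simp: axis_def)
  then show ?thesis by simp
qed

lemma lorentz_axis_left: "lorentz k (axis \<alpha> c) Z = eps k \<alpha> * (Z $ \<alpha> \<bullet> c)"
  by (simp only: lorentz_axis lorentz_commute[of k "axis \<alpha> c"])

lemma J_axis: "J (axis \<alpha> c) = axis \<alpha> (\<i> * c)"
  by (simp add: J_def vec_eq_iff axis_def)

lemma has_derivative_lorentz_diag:
  "((\<lambda>Z. lorentz k Z Z) has_derivative (\<lambda>V. 2 * lorentz k Z V)) (at Z)"
proof -
  have "((\<lambda>Z. lorentz k Z Z) has_derivative (\<lambda>V. lorentz k Z V + lorentz k V Z)) (at Z)"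
    by (rule lorentz.FDERIV) auto
  then show ?thesis by (simp add: lorentz_commute[of k _ Z])
qed

lemma open_timelike_domain: "open (timelike_domain k)"
proof -
  have "continuous_on UNIV (\<lambda>Z. lorentz k Z Z)"
    by (intro continuous_at_imp_continuous_on ballI has_derivative_continuous)
      (rule has_derivative_lorentz_diag)
  then show ?thesis
    unfolding timelike_domain_def by (intro open_Collect_less) auto
qed

lemma times_differentiable_on_lorentz_diag:
  "times_differentiable_on m (\<lambda>Z. lorentz k Z Z) (timelike_domain k)"
\<comment> \<open>Going up one order first avoids an induction: the derivative of the quadratic form
  is linear in the base point.\<close>
proof (rule times_differentiable_on_Suc_imp, rule times_differentiable_on_SucI)
  show "times_differentiable_on m (\<lambda>Z. 2 * lorentz k Z V) (timelike_domain k)" for V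
    by (intro times_differentiable_on_bounded_linear open_timelike_domain
        bounded_linear_const_mult lorentz.bounded_linear_left)
qed (use open_timelike_domain has_derivative_lorentz_diag in auto)

text \<open>In the application \<open>a\<close>, \<open>b\<close> are the moduli of the time
  coordinates, \<open>p\<close>, \<open>r\<close> the norms of the spatial parts, and
  \<open>c\<close> the modulus of the Hermitian product. The two sides differ by at least the square
  of \<open>a * r - b * p\<close>.\<close>

lemma reversed_Cauchy_Schwarz:
  fixes a b p r :: real
  assumes "0 \<le> p" "p \<le> a" "0 \<le> r" "r < b" "a > 0" "a * b - p * r \<le> c"
  shows "(a\<^sup>2 - p\<^sup>2) * (b\<^sup>2 - r\<^sup>2) \<le> c\<^sup>2" "c > 0"
proof -
  have "p * r \<le> a * r" "a * r < a * b"
    using assms by (auto intro: mult_right_mono)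
  then have *: "0 < a * b - p * r" by simp
  then show "c > 0" using assms by simp
  have "(a\<^sup>2 - p\<^sup>2) * (b\<^sup>2 - r\<^sup>2) \<le> (a\<^sup>2 - p\<^sup>2) * (b\<^sup>2 - r\<^sup>2) + (a * r - b * p)\<^sup>2" by simp
  also have "\<dots> = (a * b - p * r)\<^sup>2" by (simp add: power2_eq_square algebra_simps)
  also have "\<dots> \<le> c\<^sup>2" using * assms(6) by (intro power_mono) auto
  finally show "(a\<^sup>2 - p\<^sup>2) * (b\<^sup>2 - r\<^sup>2) \<le> c\<^sup>2" .
qed

text \<open>\<open>lorentz k X Z - \<i> * lorentz k (J X) Z\<close> is the Hermitian form of signature
  \<open>(n - 1, 1)\<close> belonging to \<open>lorentz k\<close>.\<close>

lemma lorentz_reversed_Cauchy_Schwarz: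
  assumes Z: "lorentz k Z Z < 0" and X: "lorentz k X X \<le> 0" "X \<noteq> 0"
  shows "lorentz k X X * lorentz k Z Z \<le> (lorentz k X Z)\<^sup>2 + (lorentz k (J X) Z)\<^sup>2"
    and "0 < (lorentz k X Z)\<^sup>2 + (lorentz k (J X) Z)\<^sup>2"
proof -
  let ?I = "UNIV - {k}"
  define p where "p = L2_set (\<lambda>\<alpha>. norm (X $ \<alpha>)) ?I"
  define r where "r = L2_set (\<lambda>\<alpha>. norm (Z $ \<alpha>)) ?I"
  define a where "a = norm (X $ k)"
  define b where "b = norm (Z $ k)"
  define S where "S = (\<Sum>\<alpha>\<in>?I. X $ \<alpha> * cnj (Z $ \<alpha>))"
  define A where "A = S - X $ k * cnj (Z $ k)"
  have p2: "p\<^sup>2 = (\<Sum>\<alpha>\<in>?I. (norm (X $ \<alpha>))\<^sup>2)" and r2: "r\<^sup>2 = (\<Sum>\<alpha>\<in>?I. (norm (Z $ \<alpha>))\<^sup>2)"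
    by (auto simp: p_def r_def L2_set_def sum_nonneg)
  have pr: "p \<ge> 0" "r \<ge> 0" and ab: "a \<ge> 0" "b \<ge> 0" by (auto simp: p_def r_def a_def b_def)
  have XX: "lorentz k X X = p\<^sup>2 - a\<^sup>2" and ZZ: "lorentz k Z Z = r\<^sup>2 - b\<^sup>2"
    by (auto simp: lorentz_def p2 r2 a_def b_def power2_norm_eq_inner)
  have pa: "p \<le> a" by (rule power2_le_imp_le) (use X XX ab in auto)
  have rb: "r < b" by (rule power2_less_imp_less) (use Z ZZ ab in auto)
  \<comment> \<open>A vanishing time coordinate would force the spatial part to vanish too, because
    \<open>p \<le> a\<close>.\<close>
  have a0: "a > 0"
  proof (rule ccontr)
    assume "\<not> a > 0"
    then have "a = 0" "p\<^sup>2 = 0" using ab pa pr by auto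
    then have "X $ \<alpha> = 0" for \<alpha>
      using p2 by (cases "\<alpha> = k") (auto simp: a_def sum_nonneg_eq_0_iff)
    then show False using X by (simp add: vec_eq_iff)
  qed
  \<comment> \<open>The ordinary Cauchy-Schwarz inequality bounds the spatial part; the time part
    then dominates in \<open>A\<close>.\<close>
  have "norm S \<le> (\<Sum>\<alpha>\<in>?I. norm (X $ \<alpha>) * norm (Z $ \<alpha>))"
    unfolding S_def by (rule order_trans[OF norm_sum]) (simp add: norm_mult)
  also have "\<dots> \<le> p * r"
    using L2_set_mult_ineq[of "\<lambda>\<alpha>. norm (X $ \<alpha>)" "\<lambda>\<alpha>. norm (Z $ \<alpha>)" ?I] by (simp add: p_def r_def)
  finally have "a * b - p * r \<le> norm A"
    using norm_triangle_ineq2[of "X $ k * cnj (Z $ k)" S]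
    by (simp add: A_def a_def b_def norm_mult norm_minus_commute)
  note RCS = reversed_Cauchy_Schwarz[OF pr(1) pa pr(2) rb a0 this]
  have "lorentz k X Z = Re A" "lorentz k (J X) Z = - Im A"
    by (simp_all add: lorentz_def A_def S_def J_def inner_complex_def sum.distrib sum_subtractf sum_negf
        algebra_simps)
  then have N: "(lorentz k X Z)\<^sup>2 + (lorentz k (J X) Z)\<^sup>2 = (norm A)\<^sup>2"
    by (simp add: cmod_power2)
  show "lorentz k X X * lorentz k Z Z \<le> (lorentz k X Z)\<^sup>2 + (lorentz k (J X) Z)\<^sup>2"
    using RCS(1) unfolding N XX ZZ by (simp add: algebra_simps)
  show "0 < (lorentz k X Z)\<^sup>2 + (lorentz k (J X) Z)\<^sup>2"
    unfolding N using RCS(2) by simp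
qed

section \<open>The metric with potential \<open>f(-r\<^sup>2)\<close>\<close>

text \<open>With \<open>G\<^sub>\<alpha>\<^sub>\<beta>\<close> the complex Hessian of \<open>f (lorentz k Z Z)\<close>, this is
  \<open>2 * Re (\<Sum>\<alpha> \<beta>. G\<^sub>\<alpha>\<^sub>\<beta> * X $ \<alpha> * cnj (Y $ \<beta>))\<close>.\<close>

definition potential_metric :: "'n::finite \<Rightarrow> (real \<Rightarrow> real) \<Rightarrow> 'n tensor2" where
  "potential_metric k f Z X Y =
     2 * deriv f (lorentz k Z Z) * lorentz k X Y
   + 2 * deriv (deriv f) (lorentz k Z Z) *
       (lorentz k X Z * lorentz k Y Z + lorentz k (J X) Z * lorentz k (J Y) Z)"

lemma linear_potential_metric: "linear (potential_metric k f Z X)"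
  by (rule linearI) (simp_all add: potential_metric_def linear_add[OF linear_J] linear_cmul[OF linear_J]
      lorentz.add_left lorentz.add_right lorentz.scaleR_left lorentz.scaleR_right algebra_simps)

lemma potential_metric_commute: "potential_metric k f Z X Y = potential_metric k f Z Y X"
  by (simp add: potential_metric_def lorentz_commute[of k X Y] mult.commute)

text \<open>Applying \<open>J\<close> to both vectors interchanges the two products in the
  second-derivative term, with the two signs cancelling.\<close>

lemma potential_metric_J: "potential_metric k f Z (J X) (J Y) = potential_metric k f Z X Y"
  by (simp add: potential_metric_def lorentz_J J_J lorentz.minus_left algebra_simps)

lemma bilinear_potential_metric: "bilinear (potential_metric k f Z)"
proof -
  have "(\<lambda>X. potential_metric k f Z X Y) = potential_metric k f Z Y" for Y
    using potential_metric_commute by blast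
  then show ?thesis by (simp add: bilinear_def linear_potential_metric)
qed

section \<open>Positive definiteness\<close>

lemma potential_metric_pos:
  assumes "lorentz k Z Z < 0" "deriv f (lorentz k Z Z) > 0"
    "deriv f (lorentz k Z Z) + lorentz k Z Z * deriv (deriv f) (lorentz k Z Z) < 0" "X \<noteq> 0"
  shows "potential_metric k f Z X X > 0"
proof -
  define q where "q = lorentz k Z Z"
  define f1 where "f1 = deriv f q"
  define f2 where "f2 = deriv (deriv f) q"
  define h where "h = lorentz k X X"
  define A where "A = (lorentz k X Z)\<^sup>2 + (lorentz k (J X) Z)\<^sup>2"
  have g: "potential_metric k f Z X X = 2 * (f1 * h + f2 * A)"
    by (simp add: potential_metric_def q_def f1_def f2_def h_def A_def power2_eq_square algebra_simps)
  have q: "q < 0" and f1: "f1 > 0" and f12: "f1 + q * f2 < 0"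
    using assms by (simp_all add: q_def f1_def f2_def)
  have f2: "f2 > 0"
    \<comment> \<open>If \<open>f2\<close> were nonpositive, \<open>q * f2\<close> would be
      nonnegative and \<open>f1 + q * f2\<close> positive.\<close>
    using f1 f12 q by (smt (verit) mult_nonpos_nonpos)
  have A: "A \<ge> 0" by (simp add: A_def)
  have "f1 * h + f2 * A > 0"
  proof (cases "h > 0")
    case True
    then show ?thesis using f1 f2 A by (simp add: add_pos_nonneg)
  next
    case False
    then have hq: "h * q \<le> A" and A0: "A > 0"
      using lorentz_reversed_Cauchy_Schwarz[of k Z X] assms(1,4)
      by (auto simp: h_def q_def A_def)
    show ?thesis
    proof (cases "h = 0")
      case True
      then show ?thesis using f2 A0 by simp
    next
      case h: False
      have "0 < h * (f1 + q * f2)"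
        using h False f12 by (intro mult_neg_neg) auto
      also have "\<dots> = f1 * h + f2 * (h * q)" by (simp add: algebra_simps)
      also have "\<dots> \<le> f1 * h + f2 * A" using hq f2 by simp
      finally show ?thesis .
    qed
  qed
  then show ?thesis by (simp add: g)
qed

text \<open>Serves to differentiate a function through a formula known only on the time-like domain,
  which suffices because the domain is open.\<close>

lemma partial_along_eqI:
  assumes "Z \<in> timelike_domain k" "\<And>P. P \<in> timelike_domain k \<Longrightarrow> F P = G P"
    "(G has_derivative G') (at Z)"
  shows "partial_along v F Z = G' v"
proof -
  \<comment> \<open>The base point is written as the value at 0 of the line
    \<open>Z + s *\<^sub>R v\<close>, ready for the chain rule.\<close>
  have F: "(F has_derivative G') (at (Z + 0 *\<^sub>R v))"
    using has_derivative_transform_within_open[OF assms(3) open_timelike_domain assms(1)] assms(2)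
    by simp
  have "((\<lambda>s::real. Z + s *\<^sub>R v) has_derivative (\<lambda>s. s *\<^sub>R v)) (at 0)"
    by (auto intro!: derivative_eq_intros)
  from has_derivative_compose[OF this F]
  have "((\<lambda>s::real. F (Z + s *\<^sub>R v)) has_vector_derivative G' v) (at 0)"
    by (simp add: has_vector_derivative_def linear_cmul[OF has_derivative_linear[OF assms(3)]])
  then show ?thesis by (simp add: partial_along_def vector_derivative_at)
qed

context
  fixes f :: "real \<Rightarrow> real"
  assumes smooth_f: "smooth_on {..<0} f"
begin

text \<open>Third order is reached because closedness differentiates a metric that already contains
  the second derivative of \<open>f\<close>.\<close>

lemma DERIVs:
  assumes "t < 0"
  shows "(f has_field_derivative deriv f t) (at t)"
    and "(deriv f has_field_derivative deriv (deriv f) t) (at t)"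
    and "(deriv (deriv f) has_field_derivative deriv (deriv (deriv f)) t) (at t)"
  using assms smooth_f by (auto intro!: smooth_on_DERIV[of "{..<0}"] smooth_on_deriv)

lemma smooth_on_potential_metric:
  "smooth_on (timelike_domain k) (\<lambda>Z. potential_metric k f Z X Y)"
  unfolding smooth_on_def
proof
  fix m
  note [intro!] = times_differentiable_on_add[OF open_timelike_domain]
    times_differentiable_on_mult[OF open_timelike_domain]
    times_differentiable_on_const[OF open_timelike_domain]
    times_differentiable_on_bounded_linear[OF open_timelike_domain lorentz.bounded_linear_right]
  have comp: "times_differentiable_on m (\<lambda>Z. u (lorentz k Z Z)) (timelike_domain k)"
    if "smooth_on {..<0} u" for u :: "real \<Rightarrow> real"
  proof (rule times_differentiable_on_compose[where f = u and T = "{..<0}"])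
    show "times_differentiable_on m u {..<0}" using that by (simp add: smooth_on_def)
  qed (use open_timelike_domain times_differentiable_on_lorentz_diag in \<open>auto simp: timelike_domain_def\<close>)
  show "times_differentiable_on m (\<lambda>Z. potential_metric k f Z X Y) (timelike_domain k)"
    unfolding potential_metric_def
    by (auto intro!: comp[of "deriv f"] comp[of "deriv (deriv f)"] smooth_on_deriv smooth_f)
qed

lemma has_derivative_comp_lorentz_diag:
  assumes "(u has_field_derivative u') (at (lorentz k Z Z))"
  shows "((\<lambda>P. u (lorentz k P P)) has_derivative (\<lambda>V. u' * (2 * lorentz k Z V))) (at Z)"
  using has_derivative_compose[OF has_derivative_lorentz_diag assms[unfolded has_field_derivative_def]] .

section \<open>Closedness of the fundamental form\<close>

lemma frechet_derivative_fundamental_form: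
  assumes "Z \<in> timelike_domain k"
  defines "q \<equiv> lorentz k Z Z"
  shows "frechet_derivative (\<lambda>P. fundamental_form (potential_metric k f) P X Y) (at Z) V =
      4 * deriv (deriv f) q * lorentz k V Z * lorentz k (J X) Y
    + 4 * deriv (deriv (deriv f)) q * lorentz k V Z *
        (lorentz k (J X) Z * lorentz k Y Z - lorentz k X Z * lorentz k (J Y) Z)
    + 2 * deriv (deriv f) q *
        (lorentz k (J X) V * lorentz k Y Z + lorentz k (J X) Z * lorentz k Y V
         - lorentz k X V * lorentz k (J Y) Z - lorentz k X Z * lorentz k (J Y) V)"
proof -
  have t: "q < 0" using assms by (simp add: timelike_domain_def)
  note D = has_derivative_comp_lorentz_diag[OF DERIVs(2)[OF t, unfolded q_def], folded q_def]
    has_derivative_comp_lorentz_diag[OF DERIVs(3)[OF t, unfolded q_def], folded q_def]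
    lorentz.bounded_linear_right[THEN bounded_linear_imp_has_derivative]
  \<comment> \<open>Once \<open>J (J X)\<close> is reduced to \<open>- X\<close>, the base point
    enters only through \<open>q\<close> and linear factors, so the product rule suffices.\<close>
  have "((\<lambda>P. fundamental_form (potential_metric k f) P X Y) has_derivative
    (\<lambda>V. 4 * deriv (deriv f) q * lorentz k V Z * lorentz k (J X) Y
    + 4 * deriv (deriv (deriv f)) q * lorentz k V Z *
        (lorentz k (J X) Z * lorentz k Y Z - lorentz k X Z * lorentz k (J Y) Z)
    + 2 * deriv (deriv f) q *
        (lorentz k (J X) V * lorentz k Y Z + lorentz k (J X) Z * lorentz k Y V
         - lorentz k X V * lorentz k (J Y) Z - lorentz k X Z * lorentz k (J Y) V))) (at Z)"
    unfolding fundamental_form_def potential_metric_def J_J lorentz.minus_left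
    by (rule has_derivative_eq_rhs, (rule D derivative_intros)+)
      (simp only: fun_eq_iff q_def[symmetric], simp add: lorentz_commute[of k Z] algebra_simps)
  from frechet_derivative_at[OF this, symmetric] show ?thesis by simp
qed

text \<open>Put \<open>\<theta> = h'(-, Z)\<close> and \<open>\<eta> = h'(J -, Z)\<close>. The
  third-derivative terms form a multiple of the wedge of \<open>\<theta>\<close>,
  \<open>\<eta>\<close>, \<open>\<theta>\<close>, hence vanish. Among the second-derivative terms
  those with \<open>\<eta>\<close> cancel by symmetry of \<open>h'\<close>; in the others,
  \<open>\<theta>(V) h'(J X, Y)\<close> has coefficient 4 from differentiating \<open>f'\<close> and
  -4 from the product terms, by skew-adjointness of \<open>J\<close>.\<close>

lemma closed_fundamental_form:
  "closed_form_on (timelike_domain k) (fundamental_form (potential_metric k f))"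
  unfolding closed_form_on_def
proof (intro ballI allI)
  fix Z V X Y assume Z: "Z \<in> timelike_domain k"
  have anti: "lorentz k (J Y) X = - lorentz k (J X) Y" "lorentz k (J V) X = - lorentz k (J X) V"
    "lorentz k (J V) Y = - lorentz k (J Y) V"
    by (rule lorentz_J_anticommute)+
  have sym: "lorentz k Y X = lorentz k X Y" "lorentz k V X = lorentz k X V"
    "lorentz k V Y = lorentz k Y V"
    by (simp_all add: lorentz_commute)
  show "frechet_derivative (\<lambda>P. fundamental_form (potential_metric k f) P X Y) (at Z) V
      + frechet_derivative (\<lambda>P. fundamental_form (potential_metric k f) P Y V) (at Z) X
      + frechet_derivative (\<lambda>P. fundamental_form (potential_metric k f) P V X) (at Z) Y = 0"
    unfolding frechet_derivative_fundamental_form[OF Z] anti sym by (simp add: algebra_simps)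
qed

section \<open>The complex Hessian of the potential\<close>

lemma d_zbar_potential:
  assumes "Z \<in> timelike_domain k"
  shows "d_zbar \<beta> (\<lambda>Z. of_real (f (- ((timelike_radius k Z)\<^sup>2)))) Z =
    of_real (deriv f (lorentz k Z Z) * eps k \<beta>) * Z $ \<beta>"
proof -
  have t: "lorentz k Z Z < 0" using assms by (simp add: timelike_domain_def)
  have "((\<lambda>Z. complex_of_real (f (lorentz k Z Z))) has_derivative
     (\<lambda>V. of_real (deriv f (lorentz k Z Z) * (2 * lorentz k Z V)))) (at Z)"
    by (rule has_derivative_of_real has_derivative_comp_lorentz_diag DERIVs t)+
  \<comment> \<open>On the domain \<open>- lorentz k Z Z\<close> is positive, so squaring its root
    recovers it and the potential is \<open>f\<close> of the quadratic form.\<close>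
  then have "partial_along v (\<lambda>Z. complex_of_real (f (- ((timelike_radius k Z)\<^sup>2)))) Z =
      of_real (deriv f (lorentz k Z Z) * (2 * lorentz k Z v))" for v
    by (rule partial_along_eqI[OF assms, rotated])
      (simp add: timelike_domain_def timelike_radius_def)
  then show ?thesis
    by (simp add: d_zbar_def lorentz_axis complex_eq_iff inner_complex_def)
qed

text \<open>The first term comes from differentiating \<open>deriv f\<close> of the quadratic form,
  the diagonal term from differentiating the factor \<open>Z $ \<beta>\<close>.\<close>

lemma d_z_d_zbar_potential:
  assumes "Z \<in> timelike_domain k"
  shows "d_z \<alpha> (d_zbar \<beta> (\<lambda>Z. of_real (f (- ((timelike_radius k Z)\<^sup>2))))) Z =
      of_real (deriv (deriv f) (lorentz k Z Z) * eps k \<alpha> * eps k \<beta>) * cnj (Z $ \<alpha>) * Z $ \<beta>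
    + of_real (if \<alpha> = \<beta> then deriv f (lorentz k Z Z) * eps k \<beta> else 0)"
proof -
  have t: "lorentz k Z Z < 0" using assms by (simp add: timelike_domain_def)
  have D: "((\<lambda>Z. deriv f (lorentz k Z Z) * eps k \<beta>) has_derivative
     (\<lambda>V. deriv (deriv f) (lorentz k Z Z) * (2 * lorentz k Z V) * eps k \<beta>)) (at Z)"
    by (rule has_derivative_mult_left has_derivative_comp_lorentz_diag DERIVs t)+
  have "((\<lambda>Z. of_real (deriv f (lorentz k Z Z) * eps k \<beta>) * Z $ \<beta>) has_derivative
     (\<lambda>V. of_real (deriv f (lorentz k Z Z) * eps k \<beta>) * V $ \<beta>
        + of_real (deriv (deriv f) (lorentz k Z Z) * (2 * lorentz k Z V) * eps k \<beta>) * Z $ \<beta>)) (at Z)"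
    by (intro has_derivative_mult has_derivative_of_real D
        bounded_linear_imp_has_derivative bounded_linear_vec_nth)
  then have "partial_along v (d_zbar \<beta> (\<lambda>Z. of_real (f (- ((timelike_radius k Z)\<^sup>2))))) Z =
      of_real (deriv f (lorentz k Z Z) * eps k \<beta>) * v $ \<beta>
        + of_real (deriv (deriv f) (lorentz k Z Z) * (2 * lorentz k Z v) * eps k \<beta>) * Z $ \<beta>" for v
    by (rule partial_along_eqI[OF assms, rotated]) (rule d_zbar_potential)
  then show ?thesis
    by (simp add: d_z_def lorentz_axis axis_component complex_eq_iff inner_complex_def field_simps)
qed

lemma has_local_components_potential_metric:
  "has_local_components (timelike_domain k) (potential_metric k f)
     (\<lambda>\<alpha> \<beta>. d_z \<alpha> (d_zbar \<beta> (\<lambda>Z. of_real (f (- ((timelike_radius k Z)\<^sup>2))))))"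
proof -
  have axis_i: "axis \<alpha> \<i> = J (axis \<alpha> 1)" for \<alpha> :: 'a
    by (simp add: J_axis)
  have half: "potential_metric k f Z (a *\<^sub>R X) (b *\<^sub>R Y) = a * b * potential_metric k f Z X Y"
    "potential_metric k f Z (- X) Y = - potential_metric k f Z X Y"
    "potential_metric k f Z X (- Y) = - potential_metric k f Z X Y" for k Z X Y a b
    using bilinear_potential_metric[of k f Z]
    by (simp_all add: bilinear_lmul bilinear_rmul bilinear_lneg bilinear_rneg)
  have JL: "potential_metric k f Z (J X) Y = - potential_metric k f Z X (J Y)" for k Z X Y
    using potential_metric_J[of k f Z X "J Y"] by (simp add: J_J half)
  \<comment> \<open>The factor 2 matches \<open>complex_ext\<close>: each part of the mixed
    component has two terms with weight 1/4, equal by \<open>J\<close>-invariance. In the unmixed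
    components the same terms cancel.\<close>
  have re: "potential_metric k f Z (axis \<alpha> 1) (axis \<beta> 1) =
      2 * Re (d_z \<alpha> (d_zbar \<beta> (\<lambda>Z. of_real (f (- ((timelike_radius k Z)\<^sup>2))))) Z)"
    and im: "potential_metric k f Z (axis \<alpha> 1) (axis \<beta> \<i>) =
      2 * Im (d_z \<alpha> (d_zbar \<beta> (\<lambda>Z. of_real (f (- ((timelike_radius k Z)\<^sup>2))))) Z)"
    if "Z \<in> timelike_domain k" for k Z and \<alpha> \<beta> :: 'a
    unfolding d_z_d_zbar_potential[OF that] potential_metric_def J_axis
    by (auto simp: lorentz_axis_left axis_component inner_complex_def algebra_simps)
  show ?thesis
    unfolding has_local_components_def
    by (auto simp: complex_ext_def del_def delbar_def half complex_eq_iff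
        axis_i potential_metric_J JL re im[unfolded axis_i])
qed

end

theorem proposition3p5:
  fixes f :: "real \<Rightarrow> real" and k :: "'n::finite"
  assumes "CARD('n) \<ge> 2"
    and "smooth_on {..<0} f"
    and "\<And>t. t < 0 \<Longrightarrow> deriv f t > 0"
    and "\<And>t. t < 0 \<Longrightarrow> deriv f t + t * deriv (deriv f) t < 0"
  shows "\<exists>g. kaehler_metric_on (timelike_domain k) g \<and>
           has_local_components (timelike_domain k) g
             (\<lambda>\<alpha> \<beta>. d_z \<alpha> (d_zbar \<beta> (\<lambda>Z. of_real (f (- ((timelike_radius k Z)\<^sup>2))))))"
proof -
  have "potential_metric k f Z X X > 0" if "Z \<in> timelike_domain k" "X \<noteq> 0" for Z X
    using that assms(3,4) by (intro potential_metric_pos) (auto simp: timelike_domain_def)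
  then have "riemannian_metric_on (timelike_domain k) (potential_metric k f)"
    using smooth_on_potential_metric[OF assms(2)] potential_metric_commute
    by (auto simp: riemannian_metric_on_def bilinear_potential_metric)
  then have "kaehler_metric_on (timelike_domain k) (potential_metric k f)"
    by (simp add: kaehler_metric_on_def hermitian_metric_on_def open_timelike_domain
        potential_metric_J closed_fundamental_form[OF assms(2)])
  then show ?thesis
    using has_local_components_potential_metric[OF assms(2)] by blast
qed

end
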